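(* Let $S=(S_{ij})_{i,j\in\mathbb N}$ be the upper triangular matrix with $S_{ij}={j\brace i}$, the Stirling numbers of the second kind. Then for every $j\ge 1$, $$\Lambda(S)_{1j}=\log(S)_{1,j+1}.$$
   Context: $\mathbb N=\{0,1,2,\dots\}$; matrices are indexed by $\mathbb N\times\mathbb N$ (so row and column indices start at $0$). ${j\brace i}$ is the number of equivalence relations on a $j$-element set with exactly $i$ classes, with ${0\brace 0}=1$, ${0\brace i}={j\brace 0}=0$ for $i,j>0$ and ${j\brace i}=0$ for $i>j$. For an upper triangular matrix $M$ with rational entries and all diagonal entries equal to $1$, put $$\log(M)=\sum_{n\ge1}(-1)^{n+1}\frac{(M-1)^n}{n},\qquad \Lambda(M)=\sum_{n\ge0}\frac{(-1)^n}{n+1}(M-1)^n,$$ where $1$ denotes the identity matrix; each entry of these sums is a finite sum, since $M-1$ is strictly upper triangular. *)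

theory Defs
  imports
    Complex_Main
    "HOL-Library.Groups_Big_Fun"
    "HOL-Library.Disjoint_Sets"
    "HOL-Combinatorics.Stirling"
begin

section \<open>Matrices indexed by the natural numbers\<close>

type_synonym inf_mat = "nat \<Rightarrow> nat \<Rightarrow> rat"

text \<open>
  \<open>Sum_any\<close> sums a function over its whole (finite) support and returns \<open>0\<close> if the support is
  infinite.  For upper triangular matrices all supports that occur below are finite; see
  \<open>mat_mult_upper\<close>, \<open>mat_log_finite\<close> and \<open>mat_Lambda_finite\<close>.
\<close>

definition mat_one :: inf_mat where
  "mat_one i j = (if i = j then 1 else 0)"

definition mat_minus :: "inf_mat \<Rightarrow> inf_mat \<Rightarrow> inf_mat" where
  "mat_minus A B i j = A i j - B i j"

definition mat_mult :: "inf_mat \<Rightarrow> inf_mat \<Rightarrow> inf_mat" where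
  "mat_mult A B i j = Sum_any (\<lambda>k. A i k * B k j)"

primrec mat_pow :: "inf_mat \<Rightarrow> nat \<Rightarrow> inf_mat" where
  "mat_pow A 0 = mat_one"
| "mat_pow A (Suc n) = mat_mult (mat_pow A n) A"

definition mat_log :: "inf_mat \<Rightarrow> inf_mat" where
  "mat_log M i j =
     Sum_any (\<lambda>n. if n \<ge> 1 then (-1) ^ (n + 1) * mat_pow (mat_minus M mat_one) n i j / of_nat n else 0)"

definition mat_Lambda :: "inf_mat \<Rightarrow> inf_mat" where
  "mat_Lambda M i j =
     Sum_any (\<lambda>n. (-1) ^ n / of_nat (n + 1) * mat_pow (mat_minus M mat_one) n i j)"

definition upper_unitriangular :: "inf_mat \<Rightarrow> bool" where
  "upper_unitriangular M \<longleftrightarrow> (\<forall>i j. j < i \<longrightarrow> M i j = 0) \<and> (\<forall>i. M i i = 1)"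

lemma mat_mult_upper:
  assumes "\<And>i j. j < i \<Longrightarrow> A i j = 0" "\<And>i j. j < i \<Longrightarrow> B i j = 0"
  shows "mat_mult A B i j = (\<Sum>k = i..j. A i k * B k j)"
  unfolding mat_mult_def
  by (rule Sum_any.expand_superset) (use assms in \<open>auto simp: not_less[symmetric]\<close>)

lemma mat_pow_minus_one_eq_0:
  assumes "upper_unitriangular M" "j < i + n"
  shows "mat_pow (mat_minus M mat_one) n i j = 0"
  using assms(2)
proof (induction n arbitrary: j)
  case 0
  then show ?case by (simp add: mat_one_def)
next
  case (Suc n)
  have "mat_pow (mat_minus M mat_one) n i k * mat_minus M mat_one k j = 0" for k
  proof (cases "k < i + n")
    case True
    then show ?thesis using Suc.IH by simp
  next
    case False
    with Suc.prems have "j \<le> k" by simp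
    then show ?thesis using assms(1)
      by (auto simp: upper_unitriangular_def mat_minus_def mat_one_def le_less)
  qed
  then show ?case
    by (simp only: mat_pow.simps mat_mult_def Sum_any.neutral)
qed

lemma mat_log_finite:
  assumes "upper_unitriangular M"
  shows "mat_log M i j =
    (\<Sum>n = 1..j. (-1) ^ (n + 1) * mat_pow (mat_minus M mat_one) n i j / of_nat n)"
proof -
  have "mat_log M i j = (\<Sum>n = 1..j. if n \<ge> 1 then
      (-1) ^ (n + 1) * mat_pow (mat_minus M mat_one) n i j / of_nat n else 0)"
    unfolding mat_log_def
  proof (rule Sum_any.expand_superset)
    show "{n. (if n \<ge> 1 then (-1) ^ (n + 1) * mat_pow (mat_minus M mat_one) n i j / of_nat n
        else 0) \<noteq> (0::rat)} \<subseteq> {1..j}"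
    proof
      fix n
      assume n: "n \<in> {n. (if n \<ge> 1 then (-1) ^ (n + 1) * mat_pow (mat_minus M mat_one) n i j / of_nat n
        else 0) \<noteq> (0::rat)}"
      then have "n \<ge> 1" "mat_pow (mat_minus M mat_one) n i j \<noteq> 0"
        by (auto split: if_splits)
      then show "n \<in> {1..j}"
        using mat_pow_minus_one_eq_0[OF assms, of j i n] by (cases "j < i + n") auto
    qed
  qed simp
  also have "\<dots> = (\<Sum>n = 1..j. (-1) ^ (n + 1) * mat_pow (mat_minus M mat_one) n i j / of_nat n)"
    by (rule sum.cong) auto
  finally show ?thesis .
qed

lemma mat_Lambda_finite:
  assumes "upper_unitriangular M"
  shows "mat_Lambda M i j =
    (\<Sum>n = 0..j. (-1) ^ n / of_nat (n + 1) * mat_pow (mat_minus M mat_one) n i j)"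
  unfolding mat_Lambda_def
proof (rule Sum_any.expand_superset)
  show "{n. (-1) ^ n / of_nat (n + 1) * mat_pow (mat_minus M mat_one) n i j \<noteq> (0::rat)} \<subseteq> {0..j}"
  proof
    fix n
    assume "n \<in> {n. (-1) ^ n / of_nat (n + 1) * mat_pow (mat_minus M mat_one) n i j \<noteq> (0::rat)}"
    then have "mat_pow (mat_minus M mat_one) n i j \<noteq> 0"
      by auto
    then show "n \<in> {0..j}"
      using mat_pow_minus_one_eq_0[OF assms, of j i n] by (cases "j < i + n") auto
  qed
qed simp


section \<open>Stirling numbers of the second kind as numbers of equivalence relations\<close>

definition equiv_count :: "nat \<Rightarrow> nat \<Rightarrow> nat" where
  "equiv_count j i = card {r. equiv {..<j} r \<and> card ({..<j} // r) = i}"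

definition stirling_mat :: inf_mat where
  "stirling_mat i j = of_nat (equiv_count j i)"

lemma card_equiv_eq_card_partition_on:
  "card {r. equiv A r \<and> card (A // r) = k} = card {P. partition_on A P \<and> card P = k}"
proof (rule bij_betw_same_card[of "\<lambda>r. A // r"])
  have "r = s" if r: "equiv A r" and s: "equiv A s" and eq: "A // r = A // s" for r s
  proof -
    have "t \<subseteq> u" if t: "equiv A t" and u: "equiv A u" and eq: "A // t = A // u" for t u
    proof
      fix p assume "p \<in> t"
      then obtain x y where p: "p = (x, y)" "(x, y) \<in> t" by (cases p) auto
      then have xy: "x \<in> A" "y \<in> A" using equiv_type[OF t] by auto
      have "t `` {x} \<in> A // u" using xy(1) eq by (metis quotientI)
      moreover have "x \<in> t `` {x}" "y \<in> t `` {x}" using p equiv_class_self[OF t xy(1)] by auto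
      ultimately show "p \<in> u" using p(1) in_quotient_imp_in_rel[OF u] by blast
    qed
    from this[OF r s eq] this[OF s r eq[symmetric]] show ?thesis by blast
  qed
  then have "inj_on (\<lambda>r. A // r) {r. equiv A r \<and> card (A // r) = k}"
    by (auto intro!: inj_onI)
  then show "bij_betw (\<lambda>r. A // r) {r. equiv A r \<and> card (A // r) = k}
      {P. partition_on A P \<and> card P = k}"
    unfolding bij_betw_def by (auto simp: partition_on_alt)
qed

lemma card_partition_on_insert:
  assumes A: "finite A" "a \<notin> A"
  shows "card {P. partition_on (insert a A) P \<and> card P = Suc k} =
    Suc k * card {P. partition_on A P \<and> card P = Suc k} + card {P. partition_on A P \<and> card P = k}"
proof -
  define Pt where "Pt = (\<lambda>k. {P. partition_on A P \<and> card P = k})"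
  define f where "f = (\<lambda>(P, B). insert (insert a B) (P - {B}))"
  define D where "D = (SIGMA P : Pt (Suc k). P)"
  have finPt: "finite (Pt k)" for k
    unfolding Pt_def using finitely_many_partition_on[OF A(1)] by (rule rev_finite_subset) auto
  have finP: "finite P" if "P \<in> Pt k" for P k
    using that A(1) finite_elements by (auto simp: Pt_def)
  have aP: "a \<notin> B" if "P \<in> Pt k" "B \<in> P" for P B k
    using that A(2) by (auto simp: Pt_def partition_on_def)
  have inj1: "inj_on (insert {a}) (Pt k)"
  proof (rule inj_onI)
    fix P Q assume "P \<in> Pt k" "Q \<in> Pt k" "insert {a} P = insert {a} Q"
    moreover from this have "{a} \<notin> P" "{a} \<notin> Q" using aP by blast+
    ultimately show "P = Q" by (metis insert_ident)
  qed
  have inj2: "inj_on f D"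
  proof (rule inj_onI, clarify)
    fix P B Q C
    assume PB: "(P, B) \<in> D" and QC: "(Q, C) \<in> D" and eq: "f (P, B) = f (Q, C)"
    from PB have P: "P \<in> Pt (Suc k)" "B \<in> P" by (auto simp: D_def)
    from QC have Q: "Q \<in> Pt (Suc k)" "C \<in> Q" by (auto simp: D_def)
    note aPs = aP[OF P(1)] aP[OF Q(1)]
    from eq have eq': "insert (insert a B) (P - {B}) = insert (insert a C) (Q - {C})"
      by (simp add: f_def)
    then have "insert a B \<in> insert (insert a C) (Q - {C})" by blast
    then have "insert a B = insert a C" using aPs(2)[of "insert a B"] by auto
    then have BC: "B = C" using aPs P(2) Q(2) by (metis insert_ident)
    with eq' have "P - {B} = Q - {B}" using aPs by (metis Diff_iff insertI1 insert_ident)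
    then have "P = Q" using P(2) Q(2) BC by blast
    with BC show "P = Q \<and> B = C" by simp
  qed
  have disj: "insert {a} ` Pt k \<inter> f ` D = {}"
  proof -
    have False if P: "P \<in> Pt k" and Q: "Q \<in> Pt (Suc k)" "B \<in> Q"
      and eq: "insert {a} P = insert (insert a B) (Q - {B})" for P Q B
    proof -
      have "{a} \<in> insert (insert a B) (Q - {B})" using eq by blast
      moreover have "{a} \<notin> Q" using aP[OF Q(1)] by blast
      ultimately have "B \<subseteq> {a}" by blast
      moreover have "a \<notin> B" by (rule aP[OF Q])
      ultimately have "B = {}" by blast
      with Q show False by (auto simp: Pt_def partition_on_def)
    qed
    then show ?thesis by (auto simp: D_def f_def)
  qed
  have union: "{P. partition_on (insert a A) P \<and> card P = Suc k} = insert {a} ` Pt k \<union> f ` D"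
  proof (intro equalityI subsetI)
    fix Q assume "Q \<in> {P. partition_on (insert a A) P \<and> card P = Suc k}"
    then have Q: "partition_on (insert a A) Q" "card Q = Suc k" by auto
    have finQ: "finite Q" using Q(1) A(1) finite_elements by blast
    from Q(1) obtain C where C: "C \<in> Q" "a \<in> C" by (auto simp: partition_on_def)
    have ins: "insert C (Q - {C}) = Q" using C by blast
    have "disjnt C (\<Union>(Q - {C}))"
      using Q(1) C(1) by (fastforce simp: partition_on_def disjoint_def disjnt_def)
    then have part: "partition_on (insert a A - C) (Q - {C})" "C \<subseteq> insert a A"
      using Q(1) partition_on_insert[of C "Q - {C}" "insert a A"] ins by simp_all
    show "Q \<in> insert {a} ` Pt k \<union> f ` D"
    proof (cases "C = {a}")
      case True
      with part A(2) have "partition_on A (Q - {C})" by simp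
      moreover have "card (Q - {C}) = k" using Q(2) C(1) finQ by simp
      ultimately have "Q - {C} \<in> Pt k" by (simp add: Pt_def)
      then have "insert C (Q - {C}) \<in> insert {a} ` Pt k"
        unfolding True by (rule imageI)
      then show ?thesis unfolding ins by (rule UnI1)
    next
      case False
      define B where "B = C - {a}"
      have B: "B \<noteq> {}" "insert a B = C" "B \<subseteq> A" "a \<notin> B"
        using False C(2) part(2) by (auto simp: B_def)
      have AB: "A - B = insert a A - C" using B A(2) by blast
      have BQ: "B \<notin> Q - {C}"
        using part(1) B by (auto simp: partition_on_def)
      have "partition_on A (insert B (Q - {C}))"
        using part(1) B AB
        by (subst partition_on_insert) (auto simp: disjnt_def partition_on_def)
      moreover have "card (insert B (Q - {C})) = Suc k"
        using BQ finQ Q(2) C(1) by simp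
      ultimately have "(insert B (Q - {C}), B) \<in> D" by (simp add: D_def Pt_def)
      then have "f (insert B (Q - {C}), B) \<in> f ` D" by (rule imageI)
      moreover have "f (insert B (Q - {C}), B) = Q"
        using BQ B(2) ins by (simp add: f_def)
      ultimately show ?thesis by simp
    qed
  next
    fix Q assume "Q \<in> insert {a} ` Pt k \<union> f ` D"
    then consider P where "P \<in> Pt k" "Q = insert {a} P"
      | P B where "P \<in> Pt (Suc k)" "B \<in> P" "Q = insert (insert a B) (P - {B})"
      by (auto simp: D_def f_def)
    then show "Q \<in> {P. partition_on (insert a A) P \<and> card P = Suc k}"
    proof cases
      case 1
      have "{a} \<notin> P" using aP[OF 1(1)] by blast
      then have "card Q = Suc k" using 1 finP[OF 1(1)] by (simp add: Pt_def)
      moreover have "partition_on (insert a A) Q"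
        using 1 A(2) by (auto simp: Pt_def partition_on_def disjoint_def)
      ultimately show ?thesis by simp
    next
      case 2
      have "insert a B \<notin> P" using aP[OF 2(1)] by blast
      moreover have "card P = Suc k" using 2(1) by (simp add: Pt_def)
      ultimately have "card Q = Suc k" using 2 finP[OF 2(1)] by simp
      moreover have "partition_on (insert a A) Q"
        unfolding partition_on_def
      proof (intro conjI)
        show "\<Union>Q = insert a A" using 2 by (auto simp: Pt_def partition_on_def)
        show "{} \<notin> Q" using 2 by (auto simp: Pt_def partition_on_def)
        have "disjoint P" using 2(1) by (simp add: Pt_def partition_on_def)
        then show "disjoint Q" using 2 aP[OF 2(1)]
          unfolding disjoint_def by blast
      qed
      ultimately show ?thesis by simp
    qed
  qed
  have "card D = (\<Sum>P\<in>Pt (Suc k). card P)"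
    unfolding D_def using finPt finP by (intro card_SigmaI) auto
  also have "\<dots> = Suc k * card (Pt (Suc k))"
    by (simp add: Pt_def)
  finally have "card (f ` D) = Suc k * card (Pt (Suc k))"
    using card_image[OF inj2] by simp
  moreover have "finite D" unfolding D_def using finPt finP by blast
  ultimately show ?thesis
    unfolding union using disj card_image[OF inj1] finPt
    by (subst card_Un_disjoint) (auto simp: Pt_def)
qed

lemma equiv_count_eq_Stirling: "equiv_count j i = Stirling j i"
proof -
  have "card {P. partition_on {..<j} P \<and> card P = i} = Stirling j i"
  proof (induction j i rule: Stirling.induct)
    case 1
    have "{P. partition_on {..<0::nat} P \<and> card P = 0} = {{}}"
      by (auto simp: partition_on_empty)
    then show ?case by simp
  next
    case (2 k)
    then show ?case by (auto simp: partition_on_empty card_eq_0_iff)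
  next
    case (3 n)
    have "card P \<noteq> 0" if P: "partition_on {..<Suc n} P" for P
    proof -
      have "finite P" using P finite_elements by blast
      moreover have "P \<noteq> {}" using P by (auto simp: partition_on_def)
      ultimately show ?thesis by simp
    qed
    then have "{P. partition_on {..<Suc n} P \<and> card P = 0} = {}" by auto
    then show ?case by (simp only: card.empty Stirling.simps)
  next
    case (4 n k)
    then show ?case
      using card_partition_on_insert[of "{..<n}" n k] by (simp add: lessThan_Suc)
  qed
  then show ?thesis
    by (simp add: equiv_count_def card_equiv_eq_card_partition_on)
qed

lemma upper_unitriangular_stirling_mat: "upper_unitriangular stirling_mat"
  by (simp add: upper_unitriangular_def stirling_mat_def equiv_count_eq_Stirling)

end

theory Submission
  imports
    Defs
    "HOL-Computational_Algebra.Polynomial"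
    "HOL-Computational_Algebra.Formal_Power_Series"
begin

text \<open>
  For \<open>f = exp X - 1\<close>, row \<open>1\<close> of the \<open>n\<close>-th power of \<open>S\<close> has the \<open>n\<close>-th iterate of \<open>f\<close> as
  exponential generating function. Let \<open>T g = g \<circ> f - g\<close>, and let \<open>l = log (1 + T) X\<close> and
  \<open>\<lambda> = (log (1 + T) / T) X\<close> be the generating functions of the rows \<open>1\<close> of \<open>log S\<close> and \<open>\<Lambda>(S)\<close>.
  As \<open>1 + T\<close> is an automorphism, \<open>log (1 + T)\<close> is a derivation commuting with it, hence
  \<open>l \<circ> f = f' l\<close>. Since \<open>f'' = f' = f + 1\<close>, differentiating gives \<open>l' \<circ> f = l' + l\<close>, that is,
  \<open>T l' = l = T \<lambda>\<close>. The kernel of \<open>T\<close> consists of the constants, so \<open>l' = \<lambda>\<close>.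
\<close>

unbundle fps_syntax

section \<open>Powers of \<open>exp X - 1\<close> and Stirling numbers\<close>

text \<open>Since \<open>f' = f + 1\<close>, the derivative of \<open>f^(k+1)\<close> is
  \<open>(k+1) * (f^(k+1) + f^k)\<close>, which on coefficients is the Stirling recurrence.\<close>

lemma fps_nth_exp_minus_one_power:
  "(((fps_exp 1 - 1) ^ i) $ j :: 'a::field_char_0) = of_nat (Stirling j i) * fact i / fact j"
proof (induction j i rule: Stirling.induct)
  case 1
  then show ?case by simp
next
  case (2 k)
  then show ?case by simp
next
  case (3 n)
  then show ?case by simp
next
  case (4 n k)
  let ?f = "fps_exp 1 - 1 :: 'a fps"
  have "of_nat (Suc n) * (?f ^ Suc k) $ Suc n = fps_deriv (?f ^ Suc k) $ n"
    by (simp only: fps_deriv_nth Suc_eq_plus1)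
  also have "fps_deriv (?f ^ Suc k) = fps_const (of_nat (Suc k)) * (?f ^ Suc k + ?f ^ k)"
    by (subst fps_deriv_power) (simp add: algebra_simps)
  also have "\<dots> $ n = of_nat (Suc k) * ((?f ^ Suc k) $ n + (?f ^ k) $ n)"
    by (simp only: fps_mult_left_const_nth fps_add_nth)
  also have "\<dots> = of_nat (Stirling (Suc n) (Suc k)) * fact (Suc k) / fact n"
    unfolding 4 by (simp add: field_simps)
  finally show ?case
    by (simp add: field_simps del: power_Suc of_nat_Suc Stirling.simps)
qed

section \<open>Binomial coefficients as polynomials\<close>

lemma poly_eq_if_eq_on_nat:
  fixes p q :: "'a::field_char_0 poly"
  assumes "\<And>n. poly p (of_nat n) = poly q (of_nat n)"
  shows "p = q"
proof (rule ccontr)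
  assume "p \<noteq> q"
  then have "finite {x. poly (p - q) x = 0}"
    by (intro poly_roots_finite) simp
  moreover have "range of_nat \<subseteq> {x. poly (p - q) x = 0}"
    using assms by auto
  ultimately have "finite (range (of_nat :: nat \<Rightarrow> 'a))"
    by (rule rev_finite_subset)
  then show False
    by (simp add: finite_image_iff inj_of_nat)
qed

primrec binomial_poly :: "nat \<Rightarrow> 'a::field_char_0 poly" where
  "binomial_poly 0 = 1"
| "binomial_poly (Suc k) = smult (1 / of_nat (Suc k)) (binomial_poly k * [:- of_nat k, 1:])"

lemma poly_binomial_poly: "poly (binomial_poly k) x = x gchoose k"
proof (induction k)
  case (Suc k)
  have "of_nat (Suc k) * (x gchoose Suc k) = (x - of_nat k) * (x gchoose k)"
    by (metis gbinomial_absorb_comp gbinomial_absorption)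
  then show ?case using Suc
    by (simp add: field_simps del: of_nat_Suc)
qed simp

lemma coeff_binomial_poly_0: "coeff (binomial_poly k) 0 = (if k = 0 then 1 else 0)"
  by (induction k) (auto simp: coeff_mult_0)

text \<open>As \<open>(1 + T)^x\<close> has \<open>x\<close>-derivative \<open>log (1 + T)\<close>
  at \<open>0\<close>, these are the coefficients of the logarithm; for \<open>k = 0\<close> both
  sides are \<open>0\<close>, by \<open>x / 0 = 0\<close>.\<close>

lemma coeff_binomial_poly_1: "coeff (binomial_poly k) 1 = (-1) ^ (k + 1) / of_nat k"
proof (induction k)
  case (Suc k)
  have "coeff (binomial_poly (Suc k) :: 'a poly) 1 =
      (coeff (binomial_poly k) 0 - of_nat k * coeff (binomial_poly k) 1) / of_nat (Suc k)"
    by (simp add: coeff_mult field_simps)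
  also have "\<dots> = (-1) ^ (Suc k + 1) / of_nat (Suc k)"
    unfolding Suc coeff_binomial_poly_0 by simp
  finally show ?case .
qed simp

section \<open>Power series in the difference operator of a substitution\<close>

locale unipotent_series =
  fixes f :: "'a::field_char_0 fps"
  assumes f_0: "f $ 0 = 0" and f_1: "f $ Suc 0 = 1"
begin

definition diff_op :: "'a fps \<Rightarrow> 'a fps" where
  "diff_op g = (g oo f) - g"

lemma diff_op_pow_Suc: "(diff_op ^^ Suc n) g = ((diff_op ^^ n) g oo f) - (diff_op ^^ n) g"
  by (simp add: diff_op_def)

text \<open>As \<open>f = X + ...\<close>, the series \<open>h oo f\<close> and \<open>h\<close>
  have the same lowest term, so each application of \<open>T\<close> raises the order.\<close>

lemma diff_op_pow_nth_eq_0: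
  assumes "\<And>i. i < m \<Longrightarrow> g $ i = 0" and "j < m + n"
  shows "(diff_op ^^ n) g $ j = 0"
  using assms(2)
proof (induction n arbitrary: j)
  case 0
  then show ?case using assms(1) by simp
next
  case (Suc n)
  let ?h = "(diff_op ^^ n) g"
  have "(?h oo f) $ j = (\<Sum>i\<in>{0..j}. if i = j then ?h $ j * (f ^ j) $ j else 0)"
    unfolding fps_compose_nth by (rule sum.cong) (use Suc in auto)
  also have "\<dots> = ?h $ j"
    by (simp add: startsby_zero_power_nth_same[OF f_0] f_1)
  finally show ?case
    by (simp add: diff_op_pow_Suc del: funpow.simps)
qed

lemma diff_op_pow_nth_eq_0': "j < n \<Longrightarrow> (diff_op ^^ n) g $ j = 0"
  by (rule diff_op_pow_nth_eq_0[of 0]) auto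

lemma diff_op_diff: "diff_op (g - h) = diff_op g - diff_op h"
  by (simp add: diff_op_def fps_compose_sub_distrib)

lemma diff_op_pow_diff: "(diff_op ^^ n) (g - h) = (diff_op ^^ n) g - (diff_op ^^ n) h"
  by (induction n) (simp_all add: diff_op_diff)

lemma diff_op_pow_sum: "(diff_op ^^ n) (sum g A) = (\<Sum>a\<in>A. (diff_op ^^ n) (g a))"
  by (induction n) (simp_all add: diff_op_def fps_compose_sum_distrib sum_subtractf)

lemma diff_op_pow_cmult: "(diff_op ^^ n) (fps_const c * g) = fps_const c * (diff_op ^^ n) g"
  by (induction n)
    (simp_all add: diff_op_def fps_compose_mult_distrib[OF f_0] right_diff_distrib)

lemma diff_op_pow_compose: "(diff_op ^^ n) (g oo f) = (diff_op ^^ n) g oo f"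
  by (induction n) (simp_all add: diff_op_def fps_compose_sub_distrib)

text \<open>The operator \<open>\<Sum>n. c n * T^n\<close>; cutting at \<open>n \<le> j\<close>
  loses nothing, as \<open>T^n g\<close> has order at least \<open>n\<close>.\<close>

definition diff_series :: "(nat \<Rightarrow> 'a) \<Rightarrow> 'a fps \<Rightarrow> 'a fps" where
  "diff_series c g = Abs_fps (\<lambda>j. \<Sum>n\<le>j. c n * (diff_op ^^ n) g $ j)"

lemma diff_series_nth:
  assumes "j \<le> m"
  shows "diff_series c g $ j = (\<Sum>n\<le>m. c n * (diff_op ^^ n) g $ j)"
  unfolding diff_series_def fps_nth_Abs_fps
  by (rule sum.mono_neutral_left) (use assms diff_op_pow_nth_eq_0' in auto)

lemma diff_series_compose: "diff_series c (g oo f) = diff_series c g oo f"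
proof (rule fps_ext)
  fix j
  have "(diff_series c g oo f) $ j =
      (\<Sum>i=0..j. (\<Sum>n\<le>j. c n * (diff_op ^^ n) g $ i) * (f ^ i) $ j)"
    unfolding fps_compose_nth by (rule sum.cong) (simp_all add: diff_series_nth[of _ j])
  also have "\<dots> = (\<Sum>n\<le>j. c n * ((diff_op ^^ n) g oo f) $ j)"
    unfolding fps_compose_nth sum_distrib_left sum_distrib_right mult.assoc by (rule sum.swap)
  also have "\<dots> = diff_series c (g oo f) $ j"
    by (simp add: diff_series_nth[of j j] diff_op_pow_compose)
  finally show "diff_series c (g oo f) $ j = (diff_series c g oo f) $ j" ..
qed

lemma diff_series_diff: "diff_series c (g - h) = diff_series c g - diff_series c h"
  by (rule fps_ext)
    (simp add: diff_series_nth[OF order.refl] diff_op_pow_diff algebra_simps sum_subtractf)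

lemma diff_series_sum: "diff_series c (sum g A) = (\<Sum>a\<in>A. diff_series c (g a))"
  by (rule fps_ext)
    (simp add: diff_series_nth[OF order.refl] diff_op_pow_sum fps_sum_nth sum_distrib_left
      sum.swap[of _ A])

lemma diff_series_cmult: "diff_series c (fps_const a * g) = fps_const a * diff_series c g"
  by (rule fps_ext)
    (simp add: diff_series_nth[OF order.refl] diff_op_pow_cmult sum_distrib_left mult.left_commute)

text \<open>\<open>T\<close> commutes with series in \<open>T\<close>, so applying it shifts the
  coefficients. This yields \<open>T \<lambda> = l\<close>.\<close>

lemma diff_op_diff_series:
  assumes "c 0 = 0"
  shows "diff_op (diff_series (\<lambda>n. c (Suc n)) g) = diff_series c g"
proof (rule fps_ext)
  fix j
  have "diff_op (diff_series (\<lambda>n. c (Suc n)) g) = diff_series (\<lambda>n. c (Suc n)) (diff_op g)"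
    by (simp add: diff_op_def diff_series_compose diff_series_diff)
  also have "\<dots> $ j = (\<Sum>n\<le>j. c (Suc n) * (diff_op ^^ Suc n) g $ j)"
    by (simp add: diff_series_nth[OF order.refl] funpow_swap1)
  also have "\<dots> = (\<Sum>n\<le>Suc j. c n * (diff_op ^^ n) g $ j)"
    unfolding sum.atMost_Suc_shift using assms by simp
  also have "\<dots> = diff_series c g $ j"
    by (rule diff_series_nth[symmetric]) simp
  finally show "diff_op (diff_series (\<lambda>n. c (Suc n)) g) $ j = diff_series c g $ j" .
qed

text \<open>The term for \<open>n = 0\<close> vanishes because of \<open>x / 0 = 0\<close>.\<close>

definition log_op :: "'a fps \<Rightarrow> 'a fps" where
  "log_op = diff_series (\<lambda>n. (-1) ^ (n + 1) / of_nat n)"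

section \<open>The logarithm as a derivation\<close>

text \<open>The \<open>j\<close>-th coefficient of \<open>(1 + T)^x g\<close> as a polynomial in
  \<open>x\<close>; its linear coefficient will give the logarithm.\<close>

definition iter_poly :: "'a fps \<Rightarrow> nat \<Rightarrow> 'a poly" where
  "iter_poly g j = (\<Sum>k\<le>j. smult ((diff_op ^^ k) g $ j) (binomial_poly k))"

text \<open>Substituting \<open>f\<close> is \<open>1 + T\<close>, so this is the binomial theorem,
  by Pascal's rule.\<close>

lemma compose_pow_eq:
  "((\<lambda>h. h oo f) ^^ n) g = (\<Sum>k\<le>n. of_nat (n choose k) * (diff_op ^^ k) g)"
proof (induction n arbitrary: g)
  case (Suc n)
  have eq: "g oo f = g + diff_op g"
    by (simp add: diff_op_def)
  have add: "(diff_op ^^ k) (g + h) = (diff_op ^^ k) g + (diff_op ^^ k) h" for k g h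
    using diff_op_pow_diff[of k "g + h" h] by (simp add: algebra_simps)
  have "((\<lambda>h. h oo f) ^^ Suc n) g = ((\<lambda>h. h oo f) ^^ n) (g oo f)"
    by (simp only: funpow_Suc_right o_apply)
  also have "\<dots> = (\<Sum>k\<le>n. of_nat (n choose k) * (diff_op ^^ k) g) +
      (\<Sum>k\<le>n. of_nat (n choose k) * (diff_op ^^ Suc k) g)"
    unfolding Suc.IH eq by (simp add: add funpow_swap1 distrib_left sum.distrib)
  also have "(\<Sum>k\<le>n. of_nat (n choose k) * (diff_op ^^ k) g) =
      (\<Sum>k\<le>Suc n. of_nat (n choose k) * (diff_op ^^ k) g)"
    by (simp add: binomial_eq_0)
  also have "\<dots> + (\<Sum>k\<le>n. of_nat (n choose k) * (diff_op ^^ Suc k) g) =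
      (\<Sum>k\<le>Suc n. of_nat (Suc n choose k) * (diff_op ^^ k) g)"
    unfolding sum.atMost_Suc_shift
    by (simp add: sum.distrib distrib_right del: funpow.simps sum.atMost_Suc)
  finally show ?case .
qed simp

lemma poly_iter_poly: "poly (iter_poly g j) (of_nat n) = ((\<lambda>h. h oo f) ^^ n) g $ j"
proof -
  have nth: "(of_nat m * h) $ j = of_nat m * h $ j" for m and h :: "'a fps"
    by (simp flip: fps_of_nat)
  have "((\<lambda>h. h oo f) ^^ n) g $ j = (\<Sum>k\<le>n. of_nat (n choose k) * (diff_op ^^ k) g $ j)"
    by (simp add: compose_pow_eq fps_sum_nth nth)
  \<comment> \<open>The bound \<open>n\<close> is exchanged for \<open>j\<close>: the binomial
    vanishes for \<open>k > n\<close>, the coefficient for \<open>k > j\<close>.\<close>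
  also have "\<dots> = (\<Sum>k\<le>max n j. of_nat (n choose k) * (diff_op ^^ k) g $ j)"
    by (rule sum.mono_neutral_left) (auto simp: binomial_eq_0)
  also have "\<dots> = (\<Sum>k\<le>j. of_nat (n choose k) * (diff_op ^^ k) g $ j)"
    by (rule sum.mono_neutral_right) (auto simp: diff_op_pow_nth_eq_0')
  also have "\<dots> = poly (iter_poly g j) (of_nat n)"
    by (simp add: iter_poly_def poly_sum poly_binomial_poly binomial_gbinomial mult.commute)
  finally show ?thesis ..
qed

lemma coeff_iter_poly_0: "coeff (iter_poly g j) 0 = g $ j"
  by (simp add: iter_poly_def coeff_sum coeff_binomial_poly_0 mult_delta_right)

lemma coeff_iter_poly_1: "coeff (iter_poly g j) 1 = log_op g $ j"
  unfolding iter_poly_def log_op_def diff_series_nth[OF order.refl] coeff_sum coeff_smult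
    coeff_binomial_poly_1
  by (simp add: mult.commute)

text \<open>Iterated substitution is multiplicative, so both polynomials agree at every natural
  number.\<close>

lemma iter_poly_mult: "iter_poly (g * h) j = (\<Sum>i=0..j. iter_poly g i * iter_poly h (j - i))"
proof (rule poly_eq_if_eq_on_nat)
  fix n
  have "((\<lambda>h. h oo f) ^^ n) (g * h) = ((\<lambda>h. h oo f) ^^ n) g * ((\<lambda>h. h oo f) ^^ n) h"
    by (induction n) (simp_all add: fps_compose_mult_distrib[OF f_0])
  then show "poly (iter_poly (g * h) j) (of_nat n) =
      poly (\<Sum>i=0..j. iter_poly g i * iter_poly h (j - i)) (of_nat n)"
    by (simp add: poly_sum poly_iter_poly fps_mult_nth)
qed

text \<open>The logarithm of an automorphism is a derivation: composition with the \<open>n\<close>-th iterate of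
  \<open>f\<close> is multiplicative, and \<^term>\<open>log_op\<close> is its derivative in \<open>n\<close> at \<open>0\<close>.\<close>

lemma log_op_mult: "log_op (g * h) = log_op g * h + g * log_op h"
proof (rule fps_ext)
  fix j
  have "log_op (g * h) $ j =
      (\<Sum>i=0..j. coeff (iter_poly g i * iter_poly h (j - i)) 1)"
    by (simp only: coeff_iter_poly_1[symmetric] iter_poly_mult coeff_sum)
  also have "\<dots> = (\<Sum>i=0..j. g $ i * log_op h $ (j - i) + log_op g $ i * h $ (j - i))"
    using coeff_iter_poly_1
    by (intro sum.cong) (simp_all add: coeff_mult coeff_iter_poly_0)
  also have "\<dots> = (log_op g * h + g * log_op h) $ j"
    by (simp add: fps_mult_nth sum.distrib)
  finally show "log_op (g * h) $ j = (log_op g * h + g * log_op h) $ j" .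
qed

lemma log_op_1: "log_op 1 = 0"
  using log_op_mult[of 1 1] by simp

lemma log_op_X_power: "log_op (fps_X ^ n) = fps_deriv (fps_X ^ n) * log_op fps_X"
proof (induction n)
  case (Suc n)
  then show ?case
    by (simp add: log_op_mult algebra_simps)
qed (simp add: log_op_1)

text \<open>For monomials this is the product rule, for polynomials linearity; coefficient
  \<open>j\<close> of either side depends on finitely many coefficients of \<open>g\<close>.\<close>

lemma log_op_eq_deriv: "log_op g = fps_deriv g * log_op fps_X"
proof (rule fps_ext)
  fix j
  \<comment> \<open>The cut is at \<open>Suc j\<close> because \<open>fps_deriv g $ j\<close>
    involves \<open>g $ Suc j\<close>.\<close>
  define t where "t = (\<Sum>i\<le>Suc j. fps_const (g $ i) * fps_X ^ i)"
  have t_nth: "t $ i = g $ i" if "i \<le> Suc j" for i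
    using that by (simp add: t_def fps_sum_nth fps_X_power_nth mult_delta_right del: sum.atMost_Suc)
  have "(diff_op ^^ n) g $ j = (diff_op ^^ n) t $ j" for n
    using diff_op_pow_nth_eq_0[of "Suc j" "g - t" j n] t_nth
    by (simp add: diff_op_pow_diff)
  then have "log_op g $ j = log_op t $ j"
    by (simp add: log_op_def diff_series_nth[OF order.refl])
  also have "log_op t = fps_deriv t * log_op fps_X"
  proof -
    have "log_op t = (\<Sum>i\<le>Suc j. fps_const (g $ i) * log_op (fps_X ^ i))"
      unfolding t_def log_op_def by (simp only: diff_series_sum diff_series_cmult)
    also have "\<dots> = fps_deriv t * log_op fps_X"
      unfolding t_def log_op_X_power fps_deriv_sum fps_deriv_mult_const_left sum_distrib_right
        mult.assoc ..
    finally show ?thesis .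
  qed
  also have "\<dots> $ j = (fps_deriv g * log_op fps_X) $ j"
    unfolding fps_mult_nth by (rule sum.cong) (simp_all add: t_nth)
  finally show "log_op g $ j = (fps_deriv g * log_op fps_X) $ j" .
qed

text \<open>Both sides equal \<open>log_op f\<close>, as \<open>log_op\<close> commutes with
  substituting \<open>f\<close> and \<open>fps_X oo f = f\<close>.\<close>

lemma julia_equation: "log_op fps_X oo f = fps_deriv f * log_op fps_X"
  using log_op_eq_deriv[of f] diff_series_compose[of _ fps_X]
  by (simp add: log_op_def f_0)

end

section \<open>The case \<open>f = exp X - 1\<close>\<close>

interpretation exp1: unipotent_series "fps_exp 1 - 1"
  by standard simp_all

lemma diff_op_deriv_log:
  "exp1.diff_op (fps_deriv (exp1.log_op fps_X)) = exp1.log_op fps_X"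
proof -
  let ?f = "fps_exp 1 - 1 :: 'a fps" and ?l = "exp1.log_op fps_X :: 'a fps"
  have "(fps_deriv ?l oo ?f) * fps_exp 1 = fps_deriv (?l oo ?f)"
    by (subst fps_compose_deriv) simp_all
  also have "\<dots> = (?l + fps_deriv ?l) * fps_exp 1"
    by (simp add: exp1.julia_equation algebra_simps)
  finally have "fps_deriv ?l oo ?f = ?l + fps_deriv ?l"
    by simp
  then show ?thesis
    by (simp only: exp1.diff_op_def add_diff_cancel_right')
qed

text \<open>If \<open>u\<close> had order \<open>d > 0\<close>, then coefficient
  \<open>d + 1\<close> of \<open>T u\<close> would be \<open>u $ d\<close> times that of
  \<open>f^d\<close>, a nonzero multiple of \<open>Stirling (d + 1) d\<close>.\<close>

lemma diff_op_exp_eq_0: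
  assumes "exp1.diff_op u = 0" and "u $ 0 = 0"
  shows "u = 0"
proof (rule ccontr)
  let ?f = "fps_exp 1 - 1 :: 'a fps"
  assume u: "u \<noteq> 0"
  define d where "d = subdegree u"
  have d: "u $ d \<noteq> 0"
    using u by (simp add: d_def)
  then have "d \<noteq> 0"
    using assms(2) by metis
  have "(u oo ?f) $ Suc d = u $ Suc d + u $ d * (?f ^ d) $ Suc d"
  proof -
    have "(u oo ?f) $ Suc d = (\<Sum>i\<in>{d, Suc d}. u $ i * (?f ^ i) $ Suc d)"
      unfolding fps_compose_nth by (rule sum.mono_neutral_right)
        (auto simp: d_def intro!: nth_less_subdegree_zero)
    moreover have "(?f ^ Suc d) $ Suc d = 1"
      by (simp add: fps_nth_exp_minus_one_power del: power_Suc fact_Suc)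
    ultimately show ?thesis by (simp del: power_Suc)
  qed
  moreover have "(u oo ?f) $ Suc d = u $ Suc d"
    using assms(1) by (simp add: exp1.diff_op_def)
  \<comment> \<open>Here \<open>d \<noteq> 0\<close> matters: \<open>Stirling 1 0 = 0\<close>, and
    constants do lie in the kernel.\<close>
  moreover have "Stirling (Suc d) d > 0"
    using \<open>d \<noteq> 0\<close> by (cases d) auto
  ultimately show False
    using d by (simp add: fps_nth_exp_minus_one_power del: fact_Suc)
qed

section \<open>Matrix rows as generating functions\<close>

text \<open>Row \<open>k\<close> of \<open>S\<close> has exponential generating function
  \<open>f^k / k!\<close>, so multiplying a row by \<open>S\<close> from the right substitutes
  \<open>f\<close>, and \<open>S - 1\<close> acts as \<open>T\<close>. Row \<open>1\<close> of the
  identity gives \<open>X\<close>.\<close>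

lemma mat_pow_stirling_row:
  "mat_pow (mat_minus stirling_mat mat_one) n 1 j = fact j * (exp1.diff_op ^^ n) fps_X $ j"
proof (induction n arbitrary: j)
  case 0
  then show ?case by (auto simp: mat_one_def)
next
  case (Suc n)
  let ?N = "mat_minus stirling_mat mat_one" and ?g = "(exp1.diff_op ^^ n) fps_X :: rat fps"
  have N: "?N k j = (fact j * ((fps_exp 1 - 1) ^ k) $ j / fact k) - (if k = j then 1 else 0)" for k
    by (simp add: mat_minus_def mat_one_def stirling_mat_def equiv_count_eq_Stirling
      fps_nth_exp_minus_one_power)
  have "mat_pow ?N (Suc n) 1 j = (\<Sum>k=0..j. mat_pow ?N n 1 k * ?N k j)"
    unfolding mat_pow.simps mat_mult_def
    by (rule Sum_any.expand_superset)
      (auto simp: mat_minus_def mat_one_def stirling_mat_def equiv_count_eq_Stirling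
        not_less[symmetric])
  also have "\<dots> = (\<Sum>k=0..j. fact j * (?g $ k * ((fps_exp 1 - 1) ^ k) $ j)
      - (if k = j then fact j * ?g $ j else 0))"
    by (rule sum.cong) (auto simp: Suc.IH[unfolded One_nat_def] N field_simps)
  also have "\<dots> = fact j * (exp1.diff_op ^^ Suc n) fps_X $ j"
    by (simp add: sum_subtractf exp1.diff_op_def fps_compose_nth sum_distrib_left algebra_simps)
  finally show ?case .
qed

lemma mat_log_stirling: "mat_log stirling_mat 1 j = fact j * exp1.log_op fps_X $ j"
proof -
  have "mat_log stirling_mat 1 j =
      (\<Sum>n=1..j. fact j * ((-1) ^ (n + 1) / of_nat n * (exp1.diff_op ^^ n) fps_X $ j))"
    unfolding mat_log_finite[OF upper_unitriangular_stirling_mat] mat_pow_stirling_row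
    by (simp add: mult_ac)
  also have "\<dots> = (\<Sum>n\<le>j. fact j * ((-1) ^ (n + 1) / of_nat n * (exp1.diff_op ^^ n) fps_X $ j))"
    by (rule sum.mono_neutral_left) (auto simp: not_le)
  finally show ?thesis
    by (simp add: exp1.log_op_def exp1.diff_series_nth[OF order.refl] sum_distrib_left)
qed

lemma mat_Lambda_stirling:
  "mat_Lambda stirling_mat 1 j =
    fact j * exp1.diff_series (\<lambda>n. (-1) ^ n / of_nat (n + 1)) fps_X $ j"
  unfolding mat_Lambda_finite[OF upper_unitriangular_stirling_mat] mat_pow_stirling_row
  by (simp add: exp1.diff_series_nth[OF order.refl] sum_distrib_left atLeast0AtMost mult_ac)

lemma Lambda_eq_deriv_log:
  "exp1.diff_series (\<lambda>n. (-1) ^ n / of_nat (n + 1)) fps_X = fps_deriv (exp1.log_op fps_X)"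
  (is "?L = ?D")
proof -
  have "exp1.diff_op ?L = exp1.log_op fps_X"
    using exp1.diff_op_diff_series[of "\<lambda>n. (-1) ^ (n + 1) / of_nat n" fps_X]
    by (simp add: exp1.log_op_def)
  then have "exp1.diff_op (?L - ?D) = 0"
    by (simp only: exp1.diff_op_diff diff_op_deriv_log diff_self)
  \<comment> \<open>Both constant terms vanish: that of \<open>?L\<close> is
    \<open>fps_X $ 0\<close>, that of \<open>?D\<close> is \<open>l $ 1\<close>, and
    \<open>T X = f - X\<close> has no linear term.\<close>
  moreover have "(?L - ?D) $ 0 = 0"
    by (simp add: exp1.log_op_def exp1.diff_series_nth[OF order.refl] exp1.diff_op_def)
  ultimately have "?L - ?D = 0"
    by (rule diff_op_exp_eq_0)
  then show ?thesis by simp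
qed

theorem proposition7p2:
  fixes j :: nat
  assumes "j \<ge> 1"
  shows "mat_Lambda stirling_mat 1 j = mat_log stirling_mat 1 (j + 1)"
  \<comment> \<open>Differentiation shifts the row by one place, since
    \<open>j! * (j + 1) = (j + 1)!\<close>.\<close>
  unfolding mat_Lambda_stirling mat_log_stirling Lambda_eq_deriv_log by simp

end
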